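(* Let $G$ be a group and let $I$ be a totally ordered set of indices. Then the set $CPC_I(G)$ of consistent pairwise comparisons matrices is exactly the orbit of the matrix $(1_G)_{(i,j)\in I^2}$ (all of whose coefficients equal $1_G$) under the adjoint action of $G^I$ on $PC_I(G)$.
   Context: A pairwise comparisons (PC) matrix indexed by $I$ with coefficients in $G$ is a family $A=(a_{i,j})_{(i,j)\in I^2}$ of elements of $G$ such that $a_{j,i}=a_{i,j}^{-1}$ and $a_{i,i}=1_G$ for all $i,j\in I$. $PC_I(G)$ is the set of such matrices. $A$ is consistent if $a_{i,k}=a_{i,j}a_{j,k}$ for all $i,j,k\in I$, and $CPC_I(G)$ is the set of consistent PC matrices. The group $G^I$ (the gauge group) acts on $PC_I(G)$ as follows. For $g=(g_i)_{i\in I}\in G^I$ and $A=(a_{i,j})$: $L_g(A)=(b_{i,j})$ with $b_{i,i}=1$, $b_{i,j}=g_ia_{i,j}$ if $i<j$, $b_{i,j}=a_{i,j}g_j^{-1}$ if $i>j$; $R_g(A)=(b_{i,j})$ with $b_{i,i}=1$, $b_{i,j}=a_{i,j}g_j$ if $i<j$, $b_{i,j}=g_i^{-1}a_{i,j}$ if $i>j$. The adjoint action is $Ad_g=L_g\circ R_{g^{-1}}=R_{g^{-1}}\circ L_g$, i.e. $Ad_g(A)=(g_ia_{i,j}g_j^{-1})_{(i,j)\in I^2}$. *)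

theory Defs
  imports "HOL-Algebra.Group_Action" "HOL-Algebra.Product_Groups"
begin

text \<open>
  The totally ordered index set is a carrier \<open>I\<close> with a relation \<open>r\<close> such that
  \<open>linear_order_on I r\<close>; the strict order \<open>i < j\<close> reads \<open>(i, j) \<in> r - Id\<close>.
  Matrices are extensional functions on \<open>I \<times> I\<close>, and the maps between sets of matrices are
  extensional on \<open>PC I G\<close>, as the library's \<open>BijGroup\<close> and \<open>group_action\<close> require.
\<close>

definition PC :: "'i set \<Rightarrow> ('g, 'm) monoid_scheme \<Rightarrow> ('i \<times> 'i \<Rightarrow> 'g) set" where
  "PC I G = {A \<in> I \<times> I \<rightarrow>\<^sub>E carrier G.
     (\<forall>i\<in>I. \<forall>j\<in>I. A (j, i) = inv\<^bsub>G\<^esub> A (i, j)) \<and> (\<forall>i\<in>I. A (i, i) = \<one>\<^bsub>G\<^esub>)}"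

definition CPC :: "'i set \<Rightarrow> ('g, 'm) monoid_scheme \<Rightarrow> ('i \<times> 'i \<Rightarrow> 'g) set" where
  "CPC I G = {A \<in> PC I G.
     \<forall>i\<in>I. \<forall>j\<in>I. \<forall>k\<in>I. A (i, k) = A (i, j) \<otimes>\<^bsub>G\<^esub> A (j, k)}"

definition one_matrix :: "'i set \<Rightarrow> ('g, 'm) monoid_scheme \<Rightarrow> 'i \<times> 'i \<Rightarrow> 'g" where
  "one_matrix I G = (\<lambda>_\<in>I \<times> I. \<one>\<^bsub>G\<^esub>)"

abbreviation gauge_group :: "'i set \<Rightarrow> ('g, 'm) monoid_scheme \<Rightarrow> ('i \<Rightarrow> 'g) monoid" where
  "gauge_group I G \<equiv> product_group I (\<lambda>_. G)"

definition L_action ::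
  "'i set \<Rightarrow> 'i rel \<Rightarrow> ('g, 'm) monoid_scheme \<Rightarrow> ('i \<Rightarrow> 'g) \<Rightarrow> ('i \<times> 'i \<Rightarrow> 'g) \<Rightarrow> 'i \<times> 'i \<Rightarrow> 'g" where
  "L_action I r G g = (\<lambda>A\<in>PC I G. \<lambda>(i, j)\<in>I \<times> I.
     if i = j then \<one>\<^bsub>G\<^esub>
     else if (i, j) \<in> r - Id then g i \<otimes>\<^bsub>G\<^esub> A (i, j)
     else A (i, j) \<otimes>\<^bsub>G\<^esub> inv\<^bsub>G\<^esub> g j)"

definition R_action ::
  "'i set \<Rightarrow> 'i rel \<Rightarrow> ('g, 'm) monoid_scheme \<Rightarrow> ('i \<Rightarrow> 'g) \<Rightarrow> ('i \<times> 'i \<Rightarrow> 'g) \<Rightarrow> 'i \<times> 'i \<Rightarrow> 'g" where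
  "R_action I r G g = (\<lambda>A\<in>PC I G. \<lambda>(i, j)\<in>I \<times> I.
     if i = j then \<one>\<^bsub>G\<^esub>
     else if (i, j) \<in> r - Id then A (i, j) \<otimes>\<^bsub>G\<^esub> g j
     else inv\<^bsub>G\<^esub> g i \<otimes>\<^bsub>G\<^esub> A (i, j))"

definition Ad ::
  "'i set \<Rightarrow> 'i rel \<Rightarrow> ('g, 'm) monoid_scheme \<Rightarrow> ('i \<Rightarrow> 'g) \<Rightarrow> ('i \<times> 'i \<Rightarrow> 'g) \<Rightarrow> 'i \<times> 'i \<Rightarrow> 'g" where
  "Ad I r G g = compose (PC I G) (L_action I r G g) (R_action I r G (inv\<^bsub>gauge_group I G\<^esub> g))"


lemma PC_I:
  assumes "A \<in> I \<times> I \<rightarrow>\<^sub>E carrier G"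
    and "\<And>i j. i \<in> I \<Longrightarrow> j \<in> I \<Longrightarrow> A (j, i) = inv\<^bsub>G\<^esub> A (i, j)"
    and "\<And>i. i \<in> I \<Longrightarrow> A (i, i) = \<one>\<^bsub>G\<^esub>"
  shows "A \<in> PC I G"
  using assms unfolding PC_def by blast

lemma PC_D:
  assumes "A \<in> PC I G" "i \<in> I" "j \<in> I"
  shows "A (i, j) \<in> carrier G" "A (j, i) = inv\<^bsub>G\<^esub> A (i, j)" "A (i, i) = \<one>\<^bsub>G\<^esub>"
  using assms unfolding PC_def by blast+

lemma PC_eqI:
  assumes "A \<in> PC I G" "B \<in> PC I G"
    and "\<And>i j. i \<in> I \<Longrightarrow> j \<in> I \<Longrightarrow> A (i, j) = B (i, j)"
  shows "A = B"
proof (rule PiE_ext)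
  show "A \<in> I \<times> I \<rightarrow>\<^sub>E carrier G" "B \<in> I \<times> I \<rightarrow>\<^sub>E carrier G"
    using assms(1,2) unfolding PC_def by blast+
qed (use assms(3) in blast)

lemma linear_order_cases:
  assumes "linear_order_on I r" "i \<in> I" "j \<in> I" "i \<noteq> j"
  shows "(i, j) \<in> r \<longleftrightarrow> (j, i) \<notin> r"
  using assms unfolding linear_order_on_def partial_order_on_def
  by (metis antisymD total_on_def)

lemma L_action_in_PC:
  assumes "group G" "linear_order_on I r" "g \<in> carrier (gauge_group I G)" "A \<in> PC I G"
  shows "L_action I r G g A \<in> PC I G"
proof -
  interpret group G by fact
  have g: "\<And>i. i \<in> I \<Longrightarrow> g i \<in> carrier G" using assms(3) by auto
  show ?thesis
  proof (rule PC_I)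
    fix i j assume ij: "i \<in> I" "j \<in> I"
    show "L_action I r G g A (j, i) = inv\<^bsub>G\<^esub> L_action I r G g A (i, j)"
    proof (cases "i = j")
      case False
      have "A (i, j) \<in> carrier G" "A (j, i) = inv\<^bsub>G\<^esub> A (i, j)" "g i \<in> carrier G" "g j \<in> carrier G"
        using PC_D[OF assms(4) ij] g ij by auto
      then show ?thesis
        using False ij assms(4) linear_order_cases[OF assms(2) ij False]
        by (cases "(j, i) \<in> r") (simp_all add: L_action_def inv_mult_group)
    qed (use ij assms(4) in \<open>simp add: L_action_def\<close>)
  qed (use g assms(4) PC_D(1)[OF assms(4)] in \<open>auto simp: L_action_def\<close>)
qed

lemma R_action_in_PC:
  assumes "group G" "linear_order_on I r" "g \<in> carrier (gauge_group I G)" "A \<in> PC I G"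
  shows "R_action I r G g A \<in> PC I G"
proof -
  interpret group G by fact
  have g: "\<And>i. i \<in> I \<Longrightarrow> g i \<in> carrier G" using assms(3) by auto
  show ?thesis
  proof (rule PC_I)
    fix i j assume ij: "i \<in> I" "j \<in> I"
    show "R_action I r G g A (j, i) = inv\<^bsub>G\<^esub> R_action I r G g A (i, j)"
    proof (cases "i = j")
      case False
      have "A (i, j) \<in> carrier G" "A (j, i) = inv\<^bsub>G\<^esub> A (i, j)" "g i \<in> carrier G" "g j \<in> carrier G"
        using PC_D[OF assms(4) ij] g ij by auto
      then show ?thesis
        using False ij assms(4) linear_order_cases[OF assms(2) ij False]
        by (cases "(j, i) \<in> r") (simp_all add: R_action_def inv_mult_group)
    qed (use ij assms(4) in \<open>simp add: R_action_def\<close>)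
  qed (use g assms(4) PC_D(1)[OF assms(4)] in \<open>auto simp: R_action_def\<close>)
qed

lemma Ad_extensional: "Ad I r G g \<in> extensional (PC I G)"
  by (simp add: Ad_def)

lemma Ad_in_PC:
  assumes "group G" "linear_order_on I r" "g \<in> carrier (gauge_group I G)" "A \<in> PC I G"
  shows "Ad I r G g A \<in> PC I G"
proof -
  have "inv\<^bsub>gauge_group I G\<^esub> g \<in> carrier (gauge_group I G)"
    using assms by (intro group.inv_closed) auto
  then show ?thesis
    using assms by (simp add: Ad_def compose_def L_action_in_PC R_action_in_PC)
qed

lemma Ad_apply:
  assumes "group G" "linear_order_on I r" "g \<in> carrier (gauge_group I G)" "A \<in> PC I G"
    and "i \<in> I" "j \<in> I"
  shows "Ad I r G g A (i, j) = g i \<otimes>\<^bsub>G\<^esub> A (i, j) \<otimes>\<^bsub>G\<^esub> inv\<^bsub>G\<^esub> g j"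
proof -
  interpret group G by fact
  have inv_g: "inv\<^bsub>gauge_group I G\<^esub> g \<in> carrier (gauge_group I G)"
    using assms by (intro group.inv_closed) auto
  have inv_eq: "(inv\<^bsub>gauge_group I G\<^esub> g) k = inv\<^bsub>G\<^esub> g k" if "k \<in> I" for k
    using assms that by (subst inv_product_group) auto
  have g: "\<And>i. i \<in> I \<Longrightarrow> g i \<in> carrier G" using assms(3) by auto
  show ?thesis
    using assms PC_D(1,3)[OF assms(4-6)] g inv_eq R_action_in_PC[OF assms(1,2) inv_g assms(4)]
    by (auto simp: Ad_def compose_def L_action_def R_action_def m_assoc)
qed

lemma Ad_eq_R_L:
  assumes "group G" "linear_order_on I r" "g \<in> carrier (gauge_group I G)"
  shows "Ad I r G g = compose (PC I G) (R_action I r G (inv\<^bsub>gauge_group I G\<^esub> g)) (L_action I r G g)"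
proof -
  interpret group G by fact
  have inv_g: "inv\<^bsub>gauge_group I G\<^esub> g \<in> carrier (gauge_group I G)"
    using assms by (intro group.inv_closed) auto
  have inv_eq: "(inv\<^bsub>gauge_group I G\<^esub> g) k = inv\<^bsub>G\<^esub> g k" if "k \<in> I" for k
    using assms that by (subst inv_product_group) auto
  have g: "\<And>i. i \<in> I \<Longrightarrow> g i \<in> carrier G" using assms(3) by auto
  have "Ad I r G g A = R_action I r G (inv\<^bsub>gauge_group I G\<^esub> g) (L_action I r G g A)"
    if A: "A \<in> PC I G" for A
  proof (rule PC_eqI[OF Ad_in_PC[OF assms A]])
    show "R_action I r G (inv\<^bsub>gauge_group I G\<^esub> g) (L_action I r G g A) \<in> PC I G"
      using assms inv_g A by (simp add: L_action_in_PC R_action_in_PC)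
  next
    fix i j assume ij: "i \<in> I" "j \<in> I"
    show "Ad I r G g A (i, j) = R_action I r G (inv\<^bsub>gauge_group I G\<^esub> g) (L_action I r G g A) (i, j)"
      using ij PC_D(1,3)[OF A ij] g inv_eq L_action_in_PC[OF assms A] A
      by (auto simp: Ad_apply[OF assms A ij] L_action_def R_action_def m_assoc)
  qed
  then show ?thesis
    by (intro extensionalityI[of _ "PC I G"]) (simp_all add: compose_eq Ad_extensional)
qed

lemma Ad_group_action:
  assumes "group G" "linear_order_on I r"
  shows "group_action (gauge_group I G) (PC I G) (Ad I r G)"
proof -
  interpret group G by fact
  interpret P: group "gauge_group I G" using assms by auto
  have mult: "Ad I r G (g \<otimes>\<^bsub>gauge_group I G\<^esub> h) A = Ad I r G g (Ad I r G h A)"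
    if g: "g \<in> carrier (gauge_group I G)" and h: "h \<in> carrier (gauge_group I G)"
      and A: "A \<in> PC I G" for g h A
  proof (rule PC_eqI)
    fix i j assume ij: "i \<in> I" "j \<in> I"
    have "g i \<in> carrier G" "g j \<in> carrier G" "h i \<in> carrier G" "h j \<in> carrier G"
      using g h ij by auto
    then show "Ad I r G (g \<otimes>\<^bsub>gauge_group I G\<^esub> h) A (i, j) = Ad I r G g (Ad I r G h A) (i, j)"
      using PC_D(1)[OF A ij] ij
      by (simp add: Ad_apply[OF assms P.m_closed[OF g h] A ij, simplified] Ad_apply[OF assms h A ij]
          Ad_apply[OF assms g Ad_in_PC[OF assms h A] ij] inv_mult_group m_assoc)
  qed (rule Ad_in_PC[OF assms] P.m_closed g h A)+
  have one: "Ad I r G \<one>\<^bsub>gauge_group I G\<^esub> A = A" if A: "A \<in> PC I G" for A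
    by (rule PC_eqI[OF Ad_in_PC[OF assms P.one_closed A] A])
      (use PC_D(1)[OF A] in \<open>simp add: Ad_apply[OF assms P.one_closed A, simplified]\<close>)
  have bij: "Ad I r G g \<in> Bij (PC I G)" if g: "g \<in> carrier (gauge_group I G)" for g
  proof -
    have "Ad I r G (inv\<^bsub>gauge_group I G\<^esub> g) (Ad I r G g A) = A"
      "Ad I r G g (Ad I r G (inv\<^bsub>gauge_group I G\<^esub> g) A) = A" if A: "A \<in> PC I G" for A
      using mult[OF P.inv_closed[OF g] g A] mult[OF g P.inv_closed[OF g] A] one[OF A]
      by (simp_all only: P.l_inv[OF g] P.r_inv[OF g])
    then have "bij_betw (Ad I r G g) (PC I G) (PC I G)"
      using Ad_in_PC[OF assms g] Ad_in_PC[OF assms P.inv_closed[OF g]]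
      by (intro bij_betw_byWitness[where f' = "Ad I r G (inv\<^bsub>gauge_group I G\<^esub> g)"]) blast+
    then show ?thesis
      by (simp add: Bij_def Ad_def)
  qed
  show ?thesis
    unfolding group_action_def
  proof (rule group_hom.intro)
    show "group_hom_axioms (gauge_group I G) (BijGroup (PC I G)) (Ad I r G)"
    proof
      have "Ad I r G (g \<otimes>\<^bsub>gauge_group I G\<^esub> h) = compose (PC I G) (Ad I r G g) (Ad I r G h)"
        if "g \<in> carrier (gauge_group I G)" "h \<in> carrier (gauge_group I G)" for g h
      proof
        fix A
        show "Ad I r G (g \<otimes>\<^bsub>gauge_group I G\<^esub> h) A = compose (PC I G) (Ad I r G g) (Ad I r G h) A"
          using mult[OF that, of A] by (cases "A \<in> PC I G") (auto simp: compose_def Ad_def)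
      qed
      then show "Ad I r G \<in> hom (gauge_group I G) (BijGroup (PC I G))"
        using bij by (intro homI) (auto simp: BijGroup_def simp del: mult_product_group)
    qed
  qed (rule P.group_axioms group_BijGroup)+
qed

lemma one_matrix_in_PC: "group G \<Longrightarrow> one_matrix I G \<in> PC I G"
proof -
  assume "group G"
  then interpret group G .
  show ?thesis by (auto simp: PC_def one_matrix_def)
qed

end

theory Submission
  imports Defs
begin

text \<open>
  An element of the orbit of the unit matrix has the form \<open>g\<^sub>i g\<^sub>j\<^sup>-\<^sup>1\<close>, and such a product telescopes.
  Conversely, a column \<open>g\<^sub>i = a\<^sub>i\<^sub>,\<^sub>k\<close> of a consistent matrix satisfies
  \<open>g\<^sub>i g\<^sub>j\<^sup>-\<^sup>1 = a\<^sub>i\<^sub>,\<^sub>k a\<^sub>k\<^sub>,\<^sub>j = a\<^sub>i\<^sub>,\<^sub>j\<close>.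
\<close>

lemma Ad_one_matrix:
  assumes "group G" "linear_order_on I r" "g \<in> carrier (gauge_group I G)" "i \<in> I" "j \<in> I"
  shows "Ad I r G g (one_matrix I G) (i, j) = g i \<otimes>\<^bsub>G\<^esub> inv\<^bsub>G\<^esub> g j"
proof -
  interpret group G by fact
  have "g i \<in> carrier G" using assms(3,4) by auto
  then show ?thesis
    using assms(4,5) Ad_apply[OF assms(1-3) one_matrix_in_PC[OF assms(1)] assms(4,5)]
    by (simp add: one_matrix_def)
qed

lemma Ad_one_matrix_in_CPC:
  assumes "group G" "linear_order_on I r" "g \<in> carrier (gauge_group I G)"
  shows "Ad I r G g (one_matrix I G) \<in> CPC I G"
proof -
  interpret group G by fact
  have "(g i \<otimes>\<^bsub>G\<^esub> inv\<^bsub>G\<^esub> g j) \<otimes>\<^bsub>G\<^esub> (g j \<otimes>\<^bsub>G\<^esub> inv\<^bsub>G\<^esub> g k) = g i \<otimes>\<^bsub>G\<^esub> inv\<^bsub>G\<^esub> g k"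
    if "i \<in> I" "j \<in> I" "k \<in> I" for i j k
  proof -
    have "g i \<in> carrier G" "g j \<in> carrier G" "g k \<in> carrier G"
      using assms(3) that by auto
    then show ?thesis
      \<comment> \<open>Grouping to the right cancels the common factor \<open>g i\<close>;
        regrouping to the left then brings the inverse of \<open>g j\<close> next to
        \<open>g j\<close>.\<close>
      by (simp add: m_assoc) (simp add: m_assoc[symmetric])
  qed
  then show ?thesis
    using Ad_in_PC[OF assms one_matrix_in_PC[OF assms(1)]]
    by (simp add: CPC_def Ad_one_matrix[OF assms])
qed

lemma CPC_eq_Ad_one_matrix:
  assumes "group G" "linear_order_on I r" "A \<in> CPC I G"
  obtains g where "g \<in> carrier (gauge_group I G)" "A = Ad I r G g (one_matrix I G)"
proof -
  have A: "A \<in> PC I G" using assms(3) by (simp add: CPC_def)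
  \<comment> \<open>For empty \<open>I\<close> the choice of \<open>k\<close> is junk, but \<open>g\<close> is then the empty family.\<close>
  define k where "k = (SOME k. k \<in> I)"
  \<comment> \<open>Any index at hand shows that \<open>I\<close> is nonempty, which makes the
    choice of \<open>k\<close> legitimate.\<close>
  have k: "k \<in> I" if "i \<in> I" for i
    unfolding k_def using that by (rule someI)
  define g where "g = (\<lambda>i\<in>I. A (i, k))"
  have g: "g \<in> carrier (gauge_group I G)"
    using PC_D(1)[OF A _ k] by (simp add: g_def)
  have "A = Ad I r G g (one_matrix I G)"
  proof (rule PC_eqI[OF A Ad_in_PC[OF assms(1,2) g one_matrix_in_PC[OF assms(1)]]])
    fix i j assume ij: "i \<in> I" "j \<in> I"
    have "A (i, j) = A (i, k) \<otimes>\<^bsub>G\<^esub> A (k, j)"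
      using assms(3) ij k[OF ij(1)] unfolding CPC_def by blast
    then show "A (i, j) = Ad I r G g (one_matrix I G) (i, j)"
      \<comment> \<open>Reciprocity turns the row entry \<open>A (k, j)\<close> into the inverse of
        the column entry \<open>A (j, k)\<close>, which is \<open>g j\<close>.\<close>
      using ij PC_D(2)[OF A ij(2) k[OF ij(2)]]
      unfolding Ad_one_matrix[OF assms(1,2) g ij] by (simp add: g_def)
  qed
  then show thesis using that g by blast
qed

theorem theorem3p3:
  fixes G :: "('g, 'm) monoid_scheme" and I :: "'i set" and r :: "'i rel"
  assumes "group G"
    and "linear_order_on I r"
  shows "CPC I G = orbit (gauge_group I G) (Ad I r G) (one_matrix I G)"
proof
  show "CPC I G \<subseteq> orbit (gauge_group I G) (Ad I r G) (one_matrix I G)"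
    unfolding orbit_def by (blast elim: CPC_eq_Ad_one_matrix[OF assms])
  show "orbit (gauge_group I G) (Ad I r G) (one_matrix I G) \<subseteq> CPC I G"
    unfolding orbit_def by (blast intro: Ad_one_matrix_in_CPC[OF assms])
qed

end
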